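(* Let $L$ be a two-dimensional real normed space. Then $SS(L) \leq 2$.
   Context: For a finite-dimensional real normed space $L$ with unit ball $B = \{x \in L : \|x\| \leq 1\}$, the sign-sequence constant $SS(L)$ is the least $t > 0$ such that, for each finite sequence $v_1, \ldots, v_n \in B$ (of any length $n$), there are signs $\varepsilon_1, \ldots, \varepsilon_n \in \{-1, +1\}$ such that $\varepsilon_1 v_1 + \ldots + \varepsilon_k v_k \in tB$ for each $1 \leq k \leq n$. *)

theory Defs
  imports "HOL-Analysis.Analysis"
begin

definition sign_sequence_bound :: "'a::real_normed_vector itself \<Rightarrow> real \<Rightarrow> bool" where
  "sign_sequence_bound _ t \<longleftrightarrow>
     (\<forall>(n::nat) (v :: nat \<Rightarrow> 'a). (\<forall>i\<in>{1..n}. v i \<in> cball 0 1) \<longrightarrow>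
       (\<exists>\<epsilon> :: nat \<Rightarrow> real. (\<forall>i\<in>{1..n}. \<epsilon> i \<in> {-1, 1}) \<and>
         (\<forall>k\<in>{1..n}. (\<Sum>i=1..k. \<epsilon> i *\<^sub>R v i) \<in> (\<lambda>x. t *\<^sub>R x) ` cball 0 1)))"

text \<open>The space is passed as a type, as in \<open>CARD('a)\<close>. \<open>LEAST\<close> is unspecified unless a least
  element exists; \<open>SS_least\<close> below shows that one exists as soon as a nontrivial space has
  some valid bound.\<close>

definition SS :: "'a::real_normed_vector itself \<Rightarrow> real" where
  "SS L = (LEAST t. t > 0 \<and> sign_sequence_bound L t)"

lemma scaled_unit_ball:
  fixes x :: "'a::real_normed_vector"
  assumes "t > 0"
  shows "x \<in> (\<lambda>x. t *\<^sub>R x) ` cball 0 1 \<longleftrightarrow> norm x \<le> t"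
proof
  assume "norm x \<le> t"
  then have "inverse t *\<^sub>R x \<in> cball 0 1"
    using assms by (simp add: field_simps)
  then show "x \<in> (\<lambda>x. t *\<^sub>R x) ` cball 0 1"
    by (rule rev_image_eqI) (use assms in simp)
next
  assume "x \<in> (\<lambda>x. t *\<^sub>R x) ` cball 0 1"
  then show "norm x \<le> t" using assms by (auto simp: mult_left_le)
qed

lemma sign_sequence_bound_iff:
  assumes "t > 0"
  shows "sign_sequence_bound TYPE('a::real_normed_vector) t \<longleftrightarrow>
     (\<forall>n (v :: nat \<Rightarrow> 'a). (\<forall>i\<in>{1..n}. norm (v i) \<le> 1) \<longrightarrow>
       (\<exists>\<epsilon> :: nat \<Rightarrow> real. (\<forall>i\<in>{1..n}. \<epsilon> i \<in> {-1, 1}) \<and>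
         (\<forall>k\<in>{1..n}. norm (\<Sum>i=1..k. \<epsilon> i *\<^sub>R v i) \<le> t)))"
  unfolding sign_sequence_bound_def scaled_unit_ball[OF assms] by simp

lemma sign_sequence_bound_ge_1:
  assumes "t > 0" "sign_sequence_bound TYPE('a::real_normed_vector) t" "(z::'a) \<noteq> 0"
  shows "t \<ge> 1"
proof -
  have "\<forall>i\<in>{1..1::nat}. norm (sgn z) \<le> 1" by (simp add: norm_sgn)
  from assms(2)[unfolded sign_sequence_bound_iff[OF assms(1)], THEN spec, THEN spec, THEN mp, OF this]
  obtain e :: "nat \<Rightarrow> real" where "\<forall>i\<in>{1..1}. e i \<in> {-1, 1}"
    "\<forall>k\<in>{1..1}. norm (\<Sum>i=1..k. e i *\<^sub>R sgn z) \<le> t" by blast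
  then show ?thesis using assms(3) by (auto simp: norm_sgn)
qed

lemma SS_least:
  assumes "t > 0" "sign_sequence_bound TYPE('a::real_normed_vector) t" "(z::'a) \<noteq> 0"
  shows "SS TYPE('a) > 0" "sign_sequence_bound TYPE('a) (SS TYPE('a))" "SS TYPE('a) \<le> t"
proof -
  define T where "T = {t. t > 0 \<and> sign_sequence_bound TYPE('a) t}"
  define s where "s = Inf T"
  have T1: "u \<ge> 1" if "u \<in> T" for u
    using that sign_sequence_bound_ge_1[OF _ _ assms(3)] by (auto simp: T_def)
  have "t \<in> T" using assms by (simp add: T_def)
  have s1: "s \<ge> 1" unfolding s_def using \<open>t \<in> T\<close> T1 by (intro cInf_greatest) auto
  have bdd: "bdd_below T" using T1 by (meson bdd_belowI)
  have lower: "s \<le> u" if "u \<in> T" for u unfolding s_def by (rule cInf_lower[OF that bdd])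
  have bnd: "sign_sequence_bound TYPE('a) s"
  proof (subst sign_sequence_bound_iff)
    show "s > 0" using s1 by simp
    show "\<forall>n (v :: nat \<Rightarrow> 'a). (\<forall>i\<in>{1..n}. norm (v i) \<le> 1) \<longrightarrow>
       (\<exists>\<epsilon> :: nat \<Rightarrow> real. (\<forall>i\<in>{1..n}. \<epsilon> i \<in> {-1, 1}) \<and>
         (\<forall>k\<in>{1..n}. norm (\<Sum>i=1..k. \<epsilon> i *\<^sub>R v i) \<le> s))"
    proof (intro allI impI)
      fix n and v :: "nat \<Rightarrow> 'a" assume v: "\<forall>i\<in>{1..n}. norm (v i) \<le> 1"
      define E where "E = ({1..n} \<rightarrow>\<^sub>E {-1, 1::real})"
      define M where "M e = Max (insert 0 ((\<lambda>k. norm (\<Sum>i=1..k. e i *\<^sub>R v i)) ` {1..n}))" for e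
      have fE: "finite E" unfolding E_def by (intro finite_PiE) auto
      have M: "M e \<le> u \<longleftrightarrow> (\<forall>k\<in>{1..n}. norm (\<Sum>i=1..k. e i *\<^sub>R v i) \<le> u)" if "u > 0" for e u
        using that unfolding M_def by (subst Max_le_iff) auto
      have ex: "\<exists>e\<in>E. M e \<le> u" if "u \<in> T" for u
      proof -
        have u: "u > 0" "sign_sequence_bound TYPE('a) u" using that by (auto simp: T_def)
        obtain e where e: "\<forall>i\<in>{1..n}. e i \<in> {-1, 1::real}"
          "\<forall>k\<in>{1..n}. norm (\<Sum>i=1..k. e i *\<^sub>R v i) \<le> u"
          using u(2)[unfolded sign_sequence_bound_iff[OF u(1)], rule_format, of n v] v by blast
        have "(\<Sum>i=1..k. restrict e {1..n} i *\<^sub>R v i) = (\<Sum>i=1..k. e i *\<^sub>R v i)" if "k \<in> {1..n}" for k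
          using that by (intro sum.cong) auto
        then have "M (restrict e {1..n}) \<le> u" using e(2) M[OF u(1)] by simp
        moreover have "restrict e {1..n} \<in> E" using e(1) unfolding E_def by auto
        ultimately show ?thesis by blast
      qed
      have ne: "E \<noteq> {}" using ex[OF \<open>t \<in> T\<close>] by blast
      have "Min (M ` E) \<le> u" if "u \<in> T" for u
        using ex[OF that] fE by (meson Min_le finite_imageI image_eqI order_trans)
      then have "Min (M ` E) \<le> s" unfolding s_def using \<open>t \<in> T\<close> by (intro cInf_greatest) auto
      moreover have "Min (M ` E) \<in> M ` E" using fE ne by (intro Min_in) auto
      ultimately obtain e where "e \<in> E" "M e \<le> s" by auto
      then show "\<exists>\<epsilon> :: nat \<Rightarrow> real. (\<forall>i\<in>{1..n}. \<epsilon> i \<in> {-1, 1}) \<and>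
         (\<forall>k\<in>{1..n}. norm (\<Sum>i=1..k. \<epsilon> i *\<^sub>R v i) \<le> s)"
        using M[of s e] s1 by (intro exI[of _ e]) (auto simp: E_def PiE_def Pi_def)
    qed
  qed
  have "SS TYPE('a) = s"
    unfolding SS_def using s1 bnd lower by (intro Least_equality) (auto simp: T_def)
  then show "SS TYPE('a) > 0" "sign_sequence_bound TYPE('a) (SS TYPE('a))" "SS TYPE('a) \<le> t"
    using s1 bnd lower[OF \<open>t \<in> T\<close>] by auto
qed

end

theory Submission
  imports Defs
begin

text \<open>
  Among any three vectors \<open>x\<close>, \<open>y\<close>, \<open>z\<close> of the unit ball of a plane there are two whose sum or
  difference again lies in the unit ball (\<open>mergeable_pair\<close>): they are linearly dependent, and the
  pair is the one with the two largest coefficients in absolute value. Hence the vectors of a sequence can be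
  merged into groups as they arrive, with at most two groups pending at any time: each group is a
  signed sum of vectors of the sequence, it lies in the unit ball, and only its overall sign is
  still open. When a new vector arrives, two of the two pending sums and the new vector can be
  merged by fixing their relative sign, so that again two groups are pending. At every moment
  the partial sum is \<open>\<plusminus> a \<plusminus> b\<close> for the two pending group sums \<open>a\<close> and \<open>b\<close>, so its norm is at most 2
  however the open signs are eventually chosen (\<open>pending_pair_signs\<close>).
\<close>

definition mergeable :: "'a::real_normed_vector \<Rightarrow> 'a \<Rightarrow> bool" where
  "mergeable x y \<longleftrightarrow> (\<exists>s\<in>{-1, 1::real}. norm (x + s *\<^sub>R y) \<le> 1)"

lemma mergeable_sym:
  assumes "mergeable x y"
  shows "mergeable y x"
proof -
  obtain s :: real where s: "s \<in> {-1, 1}" "norm (x + s *\<^sub>R y) \<le> 1"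
    using assms unfolding mergeable_def by blast
  then have "y + s *\<^sub>R x = s *\<^sub>R (x + s *\<^sub>R y)" by (auto simp: algebra_simps)
  then have "norm (y + s *\<^sub>R x) = \<bar>s\<bar> * norm (x + s *\<^sub>R y)" by (simp only: norm_scaleR)
  then show ?thesis using s by (auto simp: mergeable_def)
qed

text \<open>
  Solve the linear relation for the vector with the largest coefficient: \<open>z = a x + b y\<close> with
  \<open>\<bar>b\<bar> \<le> \<bar>a\<bar> \<le> 1\<close>. Removing \<open>\<plusminus> x\<close> from \<open>z\<close>, with the sign of \<open>a\<close>, leaves a vector of norm
  at most \<open>(1 - \<bar>a\<bar>) + \<bar>b\<bar> \<le> 1\<close>.
\<close>
lemma mergeable_if_ordered_relation:
  fixes x y z :: "'a::real_normed_vector"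
  assumes rel: "\<alpha> *\<^sub>R x + \<beta> *\<^sub>R y + \<gamma> *\<^sub>R z = 0"
    and ord: "\<bar>\<beta>\<bar> \<le> \<bar>\<alpha>\<bar>" "\<bar>\<alpha>\<bar> \<le> \<bar>\<gamma>\<bar>" "\<gamma> \<noteq> 0"
    and ball: "norm x \<le> 1" "norm y \<le> 1"
  shows "mergeable z x"
proof -
  define a b where "a = - \<alpha> / \<gamma>" and "b = - \<beta> / \<gamma>"
  have ab: "\<bar>b\<bar> \<le> \<bar>a\<bar>" "\<bar>a\<bar> \<le> 1"
    using ord by (auto simp: a_def b_def divide_right_mono)
  have "\<gamma> *\<^sub>R z = - (\<alpha> *\<^sub>R x + \<beta> *\<^sub>R y)"
    using rel by (simp only: add_eq_0_iff)
  then have "inverse \<gamma> *\<^sub>R (\<gamma> *\<^sub>R z) = inverse \<gamma> *\<^sub>R (- (\<alpha> *\<^sub>R x + \<beta> *\<^sub>R y))"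
    by simp
  then have z: "z = a *\<^sub>R x + b *\<^sub>R y"
    using ord by (simp add: a_def b_def scaleR_diff_right divide_inverse mult.commute)
  define s :: real where "s = (if a \<ge> 0 then -1 else 1)"
  have "z + s *\<^sub>R x = (a + s) *\<^sub>R x + b *\<^sub>R y"
    by (simp add: z scaleR_add_left)
  then have "norm (z + s *\<^sub>R x) \<le> \<bar>a + s\<bar> * norm x + \<bar>b\<bar> * norm y"
    using norm_triangle_ineq[of "(a + s) *\<^sub>R x" "b *\<^sub>R y"] by simp
  also have "\<dots> \<le> \<bar>a + s\<bar> * 1 + \<bar>b\<bar> * 1"
    using ball by (intro add_mono mult_left_mono) auto
  also have "\<dots> \<le> 1" using ab by (auto simp: s_def)
  finally show ?thesis by (auto simp: mergeable_def s_def split: if_splits)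
qed

lemma mergeable_if_relation:
  fixes x y z :: "'a::real_normed_vector"
  assumes rel: "\<alpha> *\<^sub>R x + \<beta> *\<^sub>R y + \<gamma> *\<^sub>R z = 0"
    and nontrivial: "\<not> (\<alpha> = 0 \<and> \<beta> = 0 \<and> \<gamma> = 0)"
    and ball: "norm x \<le> 1" "norm y \<le> 1" "norm z \<le> 1"
  shows "mergeable x y \<or> mergeable x z \<or> mergeable y z"
proof -
  have perms: "\<alpha> *\<^sub>R x + \<gamma> *\<^sub>R z + \<beta> *\<^sub>R y = 0" "\<beta> *\<^sub>R y + \<alpha> *\<^sub>R x + \<gamma> *\<^sub>R z = 0"
    "\<beta> *\<^sub>R y + \<gamma> *\<^sub>R z + \<alpha> *\<^sub>R x = 0" "\<gamma> *\<^sub>R z + \<alpha> *\<^sub>R x + \<beta> *\<^sub>R y = 0"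
    "\<gamma> *\<^sub>R z + \<beta> *\<^sub>R y + \<alpha> *\<^sub>R x = 0"
    using rel by (simp_all add: ac_simps)
  consider "\<bar>\<beta>\<bar> \<le> \<bar>\<alpha>\<bar>" "\<bar>\<alpha>\<bar> \<le> \<bar>\<gamma>\<bar>" "\<gamma> \<noteq> 0" | "\<bar>\<alpha>\<bar> \<le> \<bar>\<beta>\<bar>" "\<bar>\<beta>\<bar> \<le> \<bar>\<gamma>\<bar>" "\<gamma> \<noteq> 0"
    | "\<bar>\<gamma>\<bar> \<le> \<bar>\<alpha>\<bar>" "\<bar>\<alpha>\<bar> \<le> \<bar>\<beta>\<bar>" "\<beta> \<noteq> 0" | "\<bar>\<alpha>\<bar> \<le> \<bar>\<gamma>\<bar>" "\<bar>\<gamma>\<bar> \<le> \<bar>\<beta>\<bar>" "\<beta> \<noteq> 0"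
    | "\<bar>\<gamma>\<bar> \<le> \<bar>\<beta>\<bar>" "\<bar>\<beta>\<bar> \<le> \<bar>\<alpha>\<bar>" "\<alpha> \<noteq> 0" | "\<bar>\<beta>\<bar> \<le> \<bar>\<gamma>\<bar>" "\<bar>\<gamma>\<bar> \<le> \<bar>\<alpha>\<bar>" "\<alpha> \<noteq> 0"
    using nontrivial by linarith
  then show ?thesis
    using mergeable_if_ordered_relation[OF rel] perms[THEN mergeable_if_ordered_relation] ball
    by cases (blast intro: mergeable_sym)+
qed

lemma finite_basis_of_dim_2:
  assumes "dim (UNIV :: 'a::real_vector set) = 2"
  obtains B :: "'a::real_vector set" where "independent B" "span B = UNIV" "finite B" "card B = 2"
proof -
  obtain B :: "'a set" where "independent B" "UNIV \<subseteq> span B" "card B = dim (UNIV :: 'a set)"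
    using basis_exists[of UNIV] by metis
  then show thesis using assms that[of B] card.infinite[of B] by auto
qed

lemma mergeable_pair:
  fixes x y z :: "'a::real_normed_vector"
  assumes dim: "dim (UNIV :: 'a set) = 2"
    and ball: "norm x \<le> 1" "norm y \<le> 1" "norm z \<le> 1"
  shows "mergeable x y \<or> mergeable x z \<or> mergeable y z"
proof (cases "x = y \<or> x = z \<or> y = z")
  case True
  then show ?thesis by (auto simp: mergeable_def)
next
  case False
  obtain B :: "'a set" where B: "span B = UNIV" "finite B" "card B = 2"
    using finite_basis_of_dim_2[OF dim] by blast
  have "card {x, y, z} = 3" using False by auto
  then have "dependent {x, y, z}"
    using independent_span_bound[of B "{x, y, z}"] B by auto
  then obtain c where c: "\<exists>v\<in>{x, y, z}. c v \<noteq> 0" "(\<Sum>v\<in>{x, y, z}. c v *\<^sub>R v) = 0"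
    by (auto simp: dependent_finite simp del: sum.insert)
  then have "c x *\<^sub>R x + c y *\<^sub>R y + c z *\<^sub>R z = 0"
    using False by (simp add: add.assoc)
  then show ?thesis by (rule mergeable_if_relation) (use c(1) ball in auto)
qed

text \<open>
  The vectors \<open>a\<close> and \<open>b\<close> are the pending group sums, whose overall signs \<open>s\<close> and \<open>t\<close> are chosen
  only after the whole remaining sequence is known. The inclusion of \<open>k = 0\<close> bounds the partial sum
  at the moment when exactly these two groups are pending.
\<close>
lemma pending_pair_signs:
  fixes a b :: "'a::real_normed_vector" and v :: "nat \<Rightarrow> 'a"
  assumes dim: "dim (UNIV :: 'a set) = 2"
    and "norm a \<le> 1" "norm b \<le> 1" "\<And>i. i < n \<Longrightarrow> norm (v i) \<le> 1"
  shows "\<exists>s\<in>{-1, 1}. \<exists>t\<in>{-1, 1}. \<exists>\<epsilon> :: nat \<Rightarrow> real. (\<forall>i<n. \<epsilon> i \<in> {-1, 1}) \<and>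
           (\<forall>k\<le>n. norm (s *\<^sub>R a + t *\<^sub>R b + (\<Sum>i<k. \<epsilon> i *\<^sub>R v i)) \<le> 2)"
  using assms(2-)
proof (induction n arbitrary: a b v)
  case 0
  then show ?case
    using norm_triangle_ineq[of a b] by (intro bexI[of _ 1] exI[of _ "\<lambda>_. 1"]) auto
next
  case (Suc n)
  have ball: "norm a \<le> 1" "norm b \<le> 1" "norm (v 0) \<le> 1" "\<And>i. i < n \<Longrightarrow> norm (v (Suc i)) \<le> 1"
    using Suc.prems by auto
  \<comment> \<open>Signs \<open>s\<close>, \<open>t\<close>, \<open>r\<close> for \<open>a\<close>, \<open>b\<close> and \<open>v 0\<close> can be chosen once two of these are merged.\<close>
  have "\<exists>s\<in>{-1, 1}. \<exists>t\<in>{-1, 1}. \<exists>r\<in>{-1, 1}. \<exists>\<epsilon> :: nat \<Rightarrow> real. (\<forall>i<n. \<epsilon> i \<in> {-1, 1}) \<and>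
          (\<forall>k\<le>n. norm (s *\<^sub>R a + t *\<^sub>R b + r *\<^sub>R v 0 + (\<Sum>i<k. \<epsilon> i *\<^sub>R v (Suc i))) \<le> 2)"
  proof -
    have merged: "\<exists>s\<in>{-1, 1}. \<exists>t\<in>{-1, 1}. \<exists>r\<in>{-1, 1}. \<exists>\<epsilon> :: nat \<Rightarrow> real.
        (\<forall>i<n. \<epsilon> i \<in> {-1, 1}) \<and>
        (\<forall>k\<le>n. norm (s *\<^sub>R x + t *\<^sub>R y + r *\<^sub>R z + (\<Sum>i<k. \<epsilon> i *\<^sub>R v (Suc i))) \<le> 2)"
      if "mergeable x y" "norm z \<le> 1" for x y z
    proof -
      obtain \<sigma> :: real where \<sigma>: "\<sigma> \<in> {-1, 1}" "norm (x + \<sigma> *\<^sub>R y) \<le> 1"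
        using \<open>mergeable x y\<close> unfolding mergeable_def by blast
      obtain s r and \<epsilon> :: "nat \<Rightarrow> real" where signs: "s \<in> {-1, 1}" "r \<in> {-1, 1}" "\<forall>i<n. \<epsilon> i \<in> {-1, 1}"
        and bound: "\<And>k. k \<le> n \<Longrightarrow>
          norm (s *\<^sub>R (x + \<sigma> *\<^sub>R y) + r *\<^sub>R z + (\<Sum>i<k. \<epsilon> i *\<^sub>R v (Suc i))) \<le> 2"
        using Suc.IH[OF \<sigma>(2) \<open>norm z \<le> 1\<close>, of "\<lambda>i. v (Suc i)"] ball(4) by blast
      have "s * \<sigma> \<in> {-1, 1}" using signs(1) \<sigma>(1) by auto
      moreover have "\<forall>k\<le>n. norm (s *\<^sub>R x + (s * \<sigma>) *\<^sub>R y + r *\<^sub>R z + (\<Sum>i<k. \<epsilon> i *\<^sub>R v (Suc i))) \<le> 2"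
        using bound by (simp add: scaleR_add_right)
      ultimately show ?thesis using signs by blast
    qed
    consider "mergeable a b" | "mergeable a (v 0)" | "mergeable b (v 0)"
      using mergeable_pair[OF dim ball(1-3)] by blast
    then show ?thesis
    proof cases
      case 1
      from merged[OF this ball(3)] show ?thesis .
    next
      case 2
      have perm: "s *\<^sub>R a + r *\<^sub>R v 0 + t *\<^sub>R b = s *\<^sub>R a + t *\<^sub>R b + r *\<^sub>R v 0" for s t r
        by (simp add: ac_simps)
      from merged[OF 2 ball(2)] show ?thesis unfolding perm by blast
    next
      case 3
      have perm: "t *\<^sub>R b + r *\<^sub>R v 0 + s *\<^sub>R a = s *\<^sub>R a + t *\<^sub>R b + r *\<^sub>R v 0" for s t r
        by (simp add: ac_simps)
      from merged[OF 3 ball(1)] show ?thesis unfolding perm by blast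
    qed
  qed
  then obtain s t r and \<epsilon> :: "nat \<Rightarrow> real" where signs: "s \<in> {-1, 1}" "t \<in> {-1, 1}" "r \<in> {-1, 1}"
      "\<forall>i<n. \<epsilon> i \<in> {-1, 1}"
    and bound: "\<And>k. k \<le> n \<Longrightarrow>
      norm (s *\<^sub>R a + t *\<^sub>R b + r *\<^sub>R v 0 + (\<Sum>i<k. \<epsilon> i *\<^sub>R v (Suc i))) \<le> 2"
    by blast
  define \<delta> where "\<delta> = case_nat r \<epsilon>"
  have "\<forall>i<Suc n. \<delta> i \<in> {-1, 1}"
    using signs(3,4) by (auto simp: \<delta>_def split: nat.split)
  moreover have "norm (s *\<^sub>R a + t *\<^sub>R b + (\<Sum>i<k. \<delta> i *\<^sub>R v i)) \<le> 2" if "k \<le> Suc n" for k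
  proof (cases k)
    case 0
    have "norm (s *\<^sub>R a + t *\<^sub>R b) \<le> norm (s *\<^sub>R a) + norm (t *\<^sub>R b)"
      by (rule norm_triangle_ineq)
    also have "\<dots> \<le> 2" using signs(1,2) ball(1,2) by auto
    finally show ?thesis using 0 by simp
  next
    case (Suc j)
    then show ?thesis
      using bound[of j] that by (simp add: \<delta>_def sum.lessThan_Suc_shift add.assoc del: sum.lessThan_Suc)
  qed
  ultimately show ?case using signs(1,2) by blast
qed

theorem theorem1p1:
  assumes "dim (UNIV :: 'a::real_normed_vector set) = 2"
  shows "SS TYPE('a) \<le> 2"
proof -
  have bound: "sign_sequence_bound TYPE('a) 2"
  proof (subst sign_sequence_bound_iff)
    show "\<forall>n (v :: nat \<Rightarrow> 'a). (\<forall>i\<in>{1..n}. norm (v i) \<le> 1) \<longrightarrow>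
       (\<exists>\<epsilon> :: nat \<Rightarrow> real. (\<forall>i\<in>{1..n}. \<epsilon> i \<in> {-1, 1}) \<and>
         (\<forall>k\<in>{1..n}. norm (\<Sum>i=1..k. \<epsilon> i *\<^sub>R v i) \<le> 2))"
    proof (intro allI impI)
      fix n and v :: "nat \<Rightarrow> 'a"
      assume v: "\<forall>i\<in>{1..n}. norm (v i) \<le> 1"
      \<comment> \<open>Before the first vector arrives, both pending groups are empty.\<close>
      obtain \<epsilon> :: "nat \<Rightarrow> real" where "\<forall>i<n. \<epsilon> i \<in> {-1, 1}"
        "\<forall>k\<le>n. norm (\<Sum>i<k. \<epsilon> i *\<^sub>R v (Suc i)) \<le> 2"
        using pending_pair_signs[OF assms, of 0 0 n "\<lambda>i. v (Suc i)"] v by auto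
      moreover from this(1) have "\<epsilon> (i - 1) \<in> {-1, 1}" if "i \<in> {1..n}" for i
        using that by (metis One_nat_def Suc_diff_1 Suc_le_eq atLeastAtMost_iff)
      ultimately show "\<exists>\<epsilon> :: nat \<Rightarrow> real. (\<forall>i\<in>{1..n}. \<epsilon> i \<in> {-1, 1}) \<and>
         (\<forall>k\<in>{1..n}. norm (\<Sum>i=1..k. \<epsilon> i *\<^sub>R v i) \<le> 2)"
        by (intro exI[of _ "\<lambda>i. \<epsilon> (i - 1)"]) (simp add: sum.atLeast1_atMost_eq)
    qed
  qed simp
  obtain B :: "'a set" where "independent B" "card B = 2"
    using finite_basis_of_dim_2[OF assms] by blast
  then obtain z where "z \<in> B" "z \<noteq> 0"
    using dependent_zero by (metis card.empty ex_in_conv zero_neq_numeral)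
  then show ?thesis using SS_least(3)[OF _ bound] by simp
qed

end
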